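(* Let $\alpha$ and $\beta$ be compositions. Then \[\Psi_\alpha \Psi_\beta = \frac{1}{C(\alpha,\beta)}\sum_{\gamma \in \alpha\,\text{⧢}\,\beta} \Psi_\gamma,\] where $\alpha\,\text{⧢}\,\beta$ denotes the multiset of shuffles of $\alpha$ and $\beta$.
   Context: Compositions $\alpha=(\alpha_1,\dots,\alpha_k)\vDash n$ are finite sequences of positive integers summing to $n$. For compositions $\alpha\preccurlyeq\beta$ (i.e. $\alpha$ refines $\beta$), $\alpha^{(i)}$ denotes the consecutive parts of $\alpha$ summing to $\beta_i$; $\pi(\gamma)=\prod_{i=1}^{\ell(\gamma)}\sum_{j=1}^i\gamma_j$ and $\pi(\alpha,\beta)=\prod_i\pi(\alpha^{(i)})$. For a composition $\alpha$, $z_\alpha=\prod_i i^{m_i}m_i!$, where $m_i$ is the number of parts of $\alpha$ equal to $i$. The type 1 quasisymmetric power sums are $\Psi_\alpha=z_\alpha\sum_{\beta\succcurlyeq\alpha}\frac{1}{\pi(\alpha,\beta)}M_\beta$, where $M_\beta$ are the monomial quasisymmetric functions; equivalently $\Psi_\alpha$ is the basis of QSym with $\langle \Psi_\alpha,\boldsymbol{\Psi}_\beta\rangle=z_\alpha\delta_{\alpha,\beta}$, $\boldsymbol{\Psi}$ being the noncommutative power sums of the first kind. The shuffle $[a_1,\dots,a_n]\,\text{⧢}\,[b_1,\dots,b_m]$ is the set of all length $m+n$ words obtained by interleaving the two sequences, preserving the relative order of the $a_i$ and of the $b_i$. If $a_j$ (resp. $b_j$) is the number of parts of size $j$ in $\alpha$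 (resp. $\beta$), then $C(\alpha,\beta)=\prod_j\binom{a_j+b_j}{a_j}=z_{\alpha\cdot\beta}/(z_\alpha z_\beta)$, where $\alpha\cdot\beta$ is the concatenation. *)

theory Defs
  imports Complex_Main "HOL-Library.FuncSet" "HOL-Library.Multiset" "HOL-Library.Poly_Mapping"
begin

text \<open>
  A monomial in the variables \<open>x\<^sub>0, x\<^sub>1, x\<^sub>2, \<dots>\<close> is its finitely supported exponent vector, so that
  multiplication of monomials is addition of exponent vectors.  A formal power series is an
  arbitrary family of coefficients indexed by the monomials; the ring of quasisymmetric functions
  is a subring of the ring of these series, and products of quasisymmetric functions are taken
  there.
\<close>

type_synonym monomial = "nat \<Rightarrow>\<^sub>0 nat"

typedef 'a power_series = "UNIV :: (monomial \<Rightarrow> 'a) set"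
  morphisms coefficient Power_Series ..

setup_lifting type_definition_power_series

lemma power_series_eqI: "(\<And>m. coefficient F m = coefficient G m) \<Longrightarrow> F = G"
  by transfer blast

lemma finite_monomial_divisors: "finite {a :: monomial. \<exists>b. a + b = m}"
proof (rule finite_imageD)
  let ?r = "\<lambda>a :: monomial. restrict (Poly_Mapping.lookup a) (Poly_Mapping.keys m)"
  let ?D = "{a :: monomial. \<exists>b. a + b = m}"
  have le: "Poly_Mapping.lookup a i \<le> Poly_Mapping.lookup m i" if "a \<in> ?D" for a i
    using that by (auto simp: lookup_add)
  have "?r ` ?D \<subseteq> PiE (Poly_Mapping.keys m) (\<lambda>i. {..Poly_Mapping.lookup m i})"
  proof (rule image_subsetI)
    fix a assume "a \<in> ?D"
    then show "?r a \<in> PiE (Poly_Mapping.keys m) (\<lambda>i. {..Poly_Mapping.lookup m i})"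
      using le by auto
  qed
  then show "finite (?r ` ?D)"
    by (rule finite_subset) (auto intro: finite_PiE)
  show "inj_on ?r ?D"
  proof (rule inj_onI)
    fix a b assume ab: "a \<in> ?D" "b \<in> ?D" "?r a = ?r b"
    have "Poly_Mapping.lookup a i = Poly_Mapping.lookup b i" for i
    proof (cases "i \<in> Poly_Mapping.keys m")
      case True
      then show ?thesis using fun_cong[OF ab(3), of i] by simp
    next
      case False
      then have "Poly_Mapping.lookup m i = 0" by (simp add: in_keys_iff)
      then show ?thesis using le[OF ab(1), of i] le[OF ab(2), of i] by simp
    qed
    then show "a = b" by (intro poly_mapping_eqI)
  qed
qed

lemma finite_monomial_factorizations: "finite {(a :: monomial, b). a + b = m}"
proof (rule finite_subset)
  show "{(a :: monomial, b). a + b = m} \<subseteq> (\<lambda>a. (a, m - a)) ` {a. \<exists>b. a + b = m}"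
    by auto
qed (intro finite_imageI finite_monomial_divisors)

instantiation power_series :: (ab_group_add) ab_group_add
begin

lift_definition zero_power_series :: "'a power_series" is "\<lambda>_. 0" .

lift_definition plus_power_series ::
  "'a power_series \<Rightarrow> 'a power_series \<Rightarrow> 'a power_series" is "\<lambda>F G m. F m + G m" .

lift_definition uminus_power_series :: "'a power_series \<Rightarrow> 'a power_series" is "\<lambda>F m. - F m" .

lift_definition minus_power_series ::
  "'a power_series \<Rightarrow> 'a power_series \<Rightarrow> 'a power_series" is "\<lambda>F G m. F m - G m" .

instance by standard (transfer; force simp: algebra_simps)+

end

instantiation power_series :: (comm_ring_1) comm_ring_1
begin

lift_definition one_power_series :: "'a power_series" is "\<lambda>m. if m = 0 then 1 else 0" .

lift_definition times_power_series ::
  "'a power_series \<Rightarrow> 'a power_series \<Rightarrow> 'a power_series"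
  is "\<lambda>F G m. \<Sum>(a, b) \<in> {(a, b). a + b = m}. F a * G b" .

instance
proof
  fix F G H :: "'a power_series"
  show "F * G * H = F * (G * H)"
  proof (transfer, rule ext)
    fix F G H :: "monomial \<Rightarrow> 'a" and m
    let ?P = "\<lambda>m :: monomial. {(a, b). a + b = m}"
    have "(\<Sum>(a, b)\<in>?P m. (\<Sum>(c, d)\<in>?P a. F c * G d) * H b) =
        (\<Sum>x\<in>?P m. \<Sum>y\<in>?P (fst x). F (fst y) * G (snd y) * H (snd x))"
      by (simp add: case_prod_unfold sum_distrib_right)
    also have "\<dots> = (\<Sum>(x, y)\<in>Sigma (?P m) (\<lambda>x. ?P (fst x)). F (fst y) * G (snd y) * H (snd x))"
      by (subst sum.Sigma) (auto simp: finite_monomial_factorizations)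
    also have "\<dots> = (\<Sum>(x, y)\<in>Sigma (?P m) (\<lambda>x. ?P (snd x)). F (fst x) * (G (fst y) * H (snd y)))"
      by (rule sum.reindex_bij_witness
          [where j = "\<lambda>((a, b), (c, d)). ((c, d + b), (d, b))"
             and i = "\<lambda>((a, b), (c, d)). ((a + c, d), (a, c))"])
         (auto simp: algebra_simps)
    also have "\<dots> = (\<Sum>x\<in>?P m. \<Sum>y\<in>?P (snd x). F (fst x) * (G (fst y) * H (snd y)))"
      by (subst sum.Sigma) (auto simp: finite_monomial_factorizations)
    also have "\<dots> = (\<Sum>(a, b)\<in>?P m. F a * (\<Sum>(c, d)\<in>?P b. G c * H d))"
      by (simp add: case_prod_unfold sum_distrib_left)
    finally show "(\<Sum>(a, b)\<in>?P m. (\<Sum>(c, d)\<in>?P a. F c * G d) * H b) =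
        (\<Sum>(a, b)\<in>?P m. F a * (\<Sum>(c, d)\<in>?P b. G c * H d))" .
  qed
  show "F * G = G * F"
  proof (transfer, rule ext)
    fix F G :: "monomial \<Rightarrow> 'a" and m
    show "(\<Sum>(a, b)\<in>{(a, b). a + b = m}. F a * G b) = (\<Sum>(a, b)\<in>{(a, b). a + b = m}. G a * F b)"
      by (rule sum.reindex_bij_witness[where i = prod.swap and j = prod.swap])
         (auto simp: algebra_simps)
  qed
  show "1 * F = F"
  proof (transfer, rule ext)
    fix F :: "monomial \<Rightarrow> 'a" and m
    have "(\<Sum>(a, b)\<in>{(a, b). a + b = m}. (if a = 0 then 1 else 0) * F b) =
        (\<Sum>(a, b)\<in>{(0 :: monomial, m)}. (if a = 0 then 1 else 0) * F b)"
      by (rule sum.mono_neutral_right[OF finite_monomial_factorizations]) (auto split: if_splits)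
    then show "(\<Sum>(a, b)\<in>{(a, b). a + b = m}. (if a = 0 then 1 else 0) * F b) = F m"
      by simp
  qed
  show "(F + G) * H = F * H + G * H"
    by transfer (auto simp: case_prod_unfold algebra_simps sum.distrib)
  show "(0 :: 'a power_series) \<noteq> 1"
    by transfer (metis zero_neq_one)
qed

end

lift_definition scale :: "'a::comm_ring_1 \<Rightarrow> 'a power_series \<Rightarrow> 'a power_series"
  is "\<lambda>c F m. c * F m" .

definition composition :: "nat list \<Rightarrow> bool" where
  "composition \<alpha> \<longleftrightarrow> (\<forall>a\<in>set \<alpha>. 0 < a)"

definition refines :: "nat list \<Rightarrow> nat list \<Rightarrow> bool" where
  "refines \<alpha> \<beta> \<longleftrightarrow> composition \<alpha> \<and> composition \<beta> \<and>
     (\<exists>\<alpha>s. concat \<alpha>s = \<alpha> \<and> map sum_list \<alpha>s = \<beta>)"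

text \<open>The list of the compositions \<open>\<alpha>\<^bsup>(i)\<^esup>\<close>; it is unique by \<open>blocks_unique\<close> below.\<close>

definition blocks :: "nat list \<Rightarrow> nat list \<Rightarrow> nat list list" where
  "blocks \<alpha> \<beta> = (THE \<alpha>s. concat \<alpha>s = \<alpha> \<and> map sum_list \<alpha>s = \<beta>)"

lemma blocks_unique:
  assumes "composition (concat \<alpha>s)" "concat \<alpha>s = concat \<alpha>s'"
    and "map sum_list \<alpha>s = map sum_list \<alpha>s'" "composition (map sum_list \<alpha>s)"
  shows "\<alpha>s = \<alpha>s'"
  using assms
proof (induction \<alpha>s arbitrary: \<alpha>s')
  case Nil
  then show ?case by simp
next
  case (Cons a \<alpha>s)
  then obtain b \<beta>s where b: "\<alpha>s' = b # \<beta>s" by (cases \<alpha>s') auto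
  have nil: "us = []" if "sum_list us = (0::nat)" "\<forall>u\<in>set us. 0 < u" for us
    using that by (cases us) auto
  have pos: "\<forall>u\<in>set a. 0 < u" "\<forall>u\<in>set b. 0 < u"
    using Cons.prems(1) Cons.prems(1)[unfolded Cons.prems(2)] b by (auto simp: composition_def)
  from Cons.prems(2) b obtain us
    where "a = b @ us \<or> a @ us = b"
    by (auto simp: append_eq_append_conv2)
  moreover have "sum_list a = sum_list b" using Cons.prems(3) b by simp
  ultimately have "a = b" using pos nil[of us] by auto
  moreover have "\<alpha>s = \<beta>s"
  proof (rule Cons.IH)
    show "composition (concat \<alpha>s)" "composition (map sum_list \<alpha>s)"
      using Cons.prems(1,4) by (simp_all add: composition_def)
    show "concat \<alpha>s = concat \<beta>s" "map sum_list \<alpha>s = map sum_list \<beta>s"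
      using Cons.prems(2,3) b \<open>a = b\<close> by simp_all
  qed
  ultimately show ?case using b by simp
qed

lemma blocks_eqI:
  assumes "composition \<alpha>" "composition \<beta>" "concat \<alpha>s = \<alpha>" "map sum_list \<alpha>s = \<beta>"
  shows "blocks \<alpha> \<beta> = \<alpha>s"
  unfolding blocks_def
proof (rule the_equality)
  show "\<alpha>s' = \<alpha>s" if "concat \<alpha>s' = \<alpha> \<and> map sum_list \<alpha>s' = \<beta>" for \<alpha>s'
    using that assms by (intro blocks_unique) auto
qed (use assms in auto)

lemma sum_concat: "sum_list (map sum_list xss) = sum_list (concat xss)"
  by (induction xss) auto

lemma finite_coarsenings: "finite {\<beta>. refines \<alpha> \<beta>}"
proof (rule finite_subset)
  have len: "length \<beta> \<le> sum_list \<beta>" if "composition \<beta>" for \<beta>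
    using that by (induction \<beta>) (auto simp: composition_def Suc_le_eq intro: add_less_le_mono)
  have sum: "sum_list \<beta> = sum_list \<alpha>" if "refines \<alpha> \<beta>" for \<beta>
    using that by (auto simp: refines_def sum_concat)
  show "{\<beta>. refines \<alpha> \<beta>} \<subseteq>
      {\<beta>. set \<beta> \<subseteq> {..sum_list \<alpha>} \<and> length \<beta> \<le> sum_list \<alpha>}"
  proof
    fix \<beta> assume "\<beta> \<in> {\<beta>. refines \<alpha> \<beta>}"
    then have "sum_list \<beta> = sum_list \<alpha>" "length \<beta> \<le> sum_list \<beta>"
      using sum len[of \<beta>] unfolding refines_def by blast+
    then show "\<beta> \<in> {\<beta>. set \<beta> \<subseteq> {..sum_list \<alpha>} \<and> length \<beta> \<le> sum_list \<alpha>}"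
      using member_le_sum_list[of _ \<beta>] by auto
  qed
qed (rule finite_lists_length_le, simp)

definition part_pi :: "nat list \<Rightarrow> nat" where
  "part_pi \<gamma> = (\<Prod>i = 1..length \<gamma>. \<Sum>j = 1..i. \<gamma> ! (j - 1))"

definition refinement_pi :: "nat list \<Rightarrow> nat list \<Rightarrow> nat" where
  "refinement_pi \<alpha> \<beta> = prod_list (map part_pi (blocks \<alpha> \<beta>))"

definition zee :: "nat list \<Rightarrow> nat" where
  "zee \<alpha> = (\<Prod>i\<in>set \<alpha>. i ^ count_list \<alpha> i * fact (count_list \<alpha> i))"

definition shuffle_coeff :: "nat list \<Rightarrow> nat list \<Rightarrow> nat" where
  "shuffle_coeff \<alpha> \<beta> =
     (\<Prod>j\<in>set \<alpha> \<union> set \<beta>. (count_list \<alpha> j + count_list \<beta> j) choose count_list \<alpha> j)"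

text \<open>
  The shuffles of two words, counted with multiplicity: a word occurs once for every way of
  interleaving that produces it.  Forgetting the multiplicities gives \<^const>\<open>shuffles\<close>.
\<close>

fun shuffle_mset :: "'a list \<Rightarrow> 'a list \<Rightarrow> 'a list multiset" where
  "shuffle_mset [] ys = {#ys#}"
| "shuffle_mset xs [] = {#xs#}"
| "shuffle_mset (x # xs) (y # ys) =
     image_mset ((#) x) (shuffle_mset xs (y # ys)) + image_mset ((#) y) (shuffle_mset (x # xs) ys)"

lemma set_shuffle_mset: "set_mset (shuffle_mset xs ys) = shuffles xs ys"
  by (induction xs ys rule: shuffle_mset.induct) auto

lemma size_shuffle_mset:
  "size (shuffle_mset xs ys) = (length xs + length ys) choose length xs"
  by (induction xs ys rule: shuffle_mset.induct) auto

text \<open>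
  The formal sum of the monomials \<open>x\<^bsub>i\<^sub>1\<^esub>\<^bsup>\<beta>\<^sub>1\<^esup> \<cdots> x\<^bsub>i\<^sub>k\<^esub>\<^bsup>\<beta>\<^sub>k\<^esup>\<close> over all
  \<open>i\<^sub>1 < \<cdots> < i\<^sub>k\<close>: the coefficient of a monomial is the number of index sequences producing it.
\<close>

lift_definition monomial_qsym :: "nat list \<Rightarrow> 'a::comm_ring_1 power_series" is
  "\<lambda>\<beta> m. of_nat (card {is. length is = length \<beta> \<and> sorted_wrt (<) is \<and>
      sum_list (map2 Poly_Mapping.single is \<beta>) = m})" .

lemma keys_index_monomial:
  assumes "composition \<beta>" "length is = length \<beta>"
  shows "Poly_Mapping.keys (sum_list (map2 Poly_Mapping.single is \<beta>)) = set is"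
  using assms(2,1)
proof (induction "is" \<beta> rule: list_induct2)
  case (Cons i "is" b \<beta>)
  then show ?case
    by (auto simp: composition_def in_keys_iff lookup_add lookup_single set_eq_iff when_def)
qed simp

lemma finite_index_sequences:
  assumes "composition \<beta>"
  shows "finite {is. length is = length \<beta> \<and> sorted_wrt (<) is \<and>
    sum_list (map2 Poly_Mapping.single is \<beta>) = m}"
proof (rule finite_subset)
  show "{is. length is = length \<beta> \<and> sorted_wrt (<) is \<and>
      sum_list (map2 Poly_Mapping.single is \<beta>) = m} \<subseteq>
    {is. set is \<subseteq> Poly_Mapping.keys m \<and> length is = length \<beta>}"
    using keys_index_monomial[OF assms] by auto
qed (simp add: finite_lists_length_eq)

definition Psi :: "nat list \<Rightarrow> 'a::field_char_0 power_series" where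
  "Psi \<alpha> = scale (of_nat (zee \<alpha>))
     (\<Sum>\<beta> \<in> {\<beta>. refines \<alpha> \<beta>}. scale (1 / of_nat (refinement_pi \<alpha> \<beta>)) (monomial_qsym \<beta>))"

end

theory Submission
  imports Defs
begin

text \<open>
  Up to the factor \<open>z\<^sub>\<alpha>\<close>, the coefficient of a monomial \<open>m\<close> in \<open>\<Psi>\<^sub>\<alpha>\<close> is the sum, over all ways
  of cutting \<open>\<alpha>\<close> into consecutive (possibly empty) blocks, one for each variable and with sums
  the exponents of \<open>m\<close>, of the product of the numbers \<open>1 / \<pi>(block)\<close>.  Hence, in finitely many
  variables, \<open>\<Psi>\<^sub>\<alpha> / z\<^sub>\<alpha>\<close> is a convolution over deconcatenation of the one-variable functions
  \<open>v \<mapsto> x\<^bsup>|v|\<^esup> / \<pi>(v)\<close>.  These are multiplicative for the shuffle product, and convolution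
  preserves multiplicativity since deconcatenation is compatible with shuffling.
\<close>

section \<open>Shuffles and deconcatenation\<close>

lemma shuffle_mset_Nil2 [simp]: "shuffle_mset xs [] = {#xs#}"
  by (cases xs) auto

text \<open>Every interleaving ends with the last letter of one of the two words. The defining
  recursion works at the front, while \<open>part_pi\<close>, a product of prefix sums, recurses at
  the end.\<close>

lemma shuffle_mset_snoc:
  "shuffle_mset (xs @ [x]) (ys @ [y]) =
     image_mset (\<lambda>zs. zs @ [x]) (shuffle_mset xs (ys @ [y])) +
     image_mset (\<lambda>zs. zs @ [y]) (shuffle_mset (xs @ [x]) ys)"
proof (induction xs ys rule: shuffle_mset.induct)
  \<comment> \<open>In both base cases one of the words is a single letter, and the inner induction
    carries it along the other word.\<close>
  case (1 ys)
  show ?case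
    by (induction ys) (auto simp: multiset.map_comp comp_def)
next
  case (2 x' xs)
  show ?case
    by (induction xs arbitrary: x') (auto simp: multiset.map_comp comp_def)
next
  case (3 x' xs y' ys)
  then show ?case
    by (simp add: multiset.map_comp comp_def)
qed

lemma mset_shuffle_mset: "zs \<in># shuffle_mset xs ys \<Longrightarrow> mset zs = mset xs + mset ys"
  by (simp add: set_shuffle_mset mset_shuffles)

lemma composition_shuffle:
  assumes "composition \<alpha>" "composition \<beta>" "\<gamma> \<in># shuffle_mset \<alpha> \<beta>"
  shows "composition \<gamma>"
  using assms set_shuffles[of \<gamma> \<alpha> \<beta>] by (auto simp: composition_def set_shuffle_mset)

lemma composition_take: "composition \<alpha> \<Longrightarrow> composition (take k \<alpha>)"
  by (auto simp: composition_def dest: in_set_takeD)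

lemma composition_drop: "composition \<alpha> \<Longrightarrow> composition (drop k \<alpha>)"
  by (auto simp: composition_def dest: in_set_dropD)

text \<open>The product of functions on words dual to deconcatenation; \<open>k = 0\<close> and
  \<open>k = length xs\<close> give the cuts with an empty factor.\<close>

definition convolution :: "('a list \<Rightarrow> 'b::comm_ring_1) \<Rightarrow> ('a list \<Rightarrow> 'b) \<Rightarrow> 'a list \<Rightarrow> 'b" where
  "convolution f g xs = (\<Sum>k\<le>length xs. f (take k xs) * g (drop k xs))"

lemma convolution_Cons:
  "convolution f g (x # xs) = f [] * g (x # xs) + convolution (\<lambda>ys. f (x # ys)) g xs"
  by (simp add: convolution_def sum.atMost_Suc_shift del: sum.atMost_Suc)

text \<open>The bialgebra compatibility: cutting a shuffle cuts each word into a prefix and a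
  suffix, and the two pieces are arbitrary shuffles of the prefixes and of the suffixes. The
  induction removes first letters and absorbs them into \<open>f\<close>, which is therefore
  arbitrary.\<close>

lemma sum_shuffle_convolution:
  fixes f g :: "'a list \<Rightarrow> 'b::comm_ring_1"
  shows "(\<Sum>zs\<in>#shuffle_mset xs ys. convolution f g zs) =
    (\<Sum>i\<le>length xs. \<Sum>j\<le>length ys.
       (\<Sum>us\<in>#shuffle_mset (take i xs) (take j ys). f us) *
       (\<Sum>vs\<in>#shuffle_mset (drop i xs) (drop j ys). g vs))"
proof (induction xs ys arbitrary: f rule: shuffle_mset.induct)
  case (1 ys)
  show ?case by (simp add: convolution_def)
next
  case (2 x xs)
  show ?case by (simp add: convolution_def)
next
  case (3 x xs y ys)
  \<comment> \<open>\<open>T i j\<close> is the term for cuts at \<open>i\<close> and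
    \<open>j\<close>; \<open>A\<close> and \<open>B\<close> are the terms of the two induction
    hypotheses, with \<open>x\<close> or \<open>y\<close> absorbed into \<open>f\<close>.\<close>
  define A where "A = (\<lambda>i j. (\<Sum>us\<in>#shuffle_mset (take i xs) (take j (y # ys)). f (x # us)) *
      (\<Sum>vs\<in>#shuffle_mset (drop i xs) (drop j (y # ys)). g vs))"
  define B where "B = (\<lambda>i j. (\<Sum>us\<in>#shuffle_mset (take i (x # xs)) (take j ys). f (y # us)) *
      (\<Sum>vs\<in>#shuffle_mset (drop i (x # xs)) (drop j ys). g vs))"
  define T where "T = (\<lambda>i j. (\<Sum>us\<in>#shuffle_mset (take i (x # xs)) (take j (y # ys)). f us) *
      (\<Sum>vs\<in>#shuffle_mset (drop i (x # xs)) (drop j (y # ys)). g vs))"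
  \<comment> \<open>A nonempty left piece starts with \<open>x\<close> or with \<open>y\<close>; if
    one of the two prefixes is empty, only one choice remains.\<close>
  have T: "T (Suc i) 0 = A i 0" "T 0 (Suc j) = B 0 j" "T (Suc i) (Suc j) = A i (Suc j) + B (Suc i) j"
    for i j
    by (simp_all add: T_def A_def B_def multiset.map_comp comp_def distrib_right)
  have "(\<Sum>zs\<in>#shuffle_mset (x # xs) (y # ys). convolution f g zs) =
      f [] * (\<Sum>zs\<in>#shuffle_mset (x # xs) (y # ys). g zs) +
      (\<Sum>zs\<in>#shuffle_mset xs (y # ys). convolution (\<lambda>us. f (x # us)) g zs) +
      (\<Sum>zs\<in>#shuffle_mset (x # xs) ys. convolution (\<lambda>us. f (y # us)) g zs)"
    by (simp add: convolution_Cons multiset.map_comp comp_def sum_mset.distrib distrib_left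
        flip: sum_mset_distrib_left)
  \<comment> \<open>The term \<open>T 0 0\<close> is the cut before the first letter, where both
    prefixes are empty.\<close>
  also have "\<dots> = T 0 0 + (\<Sum>i\<le>length xs. \<Sum>j\<le>Suc (length ys). A i j) +
      (\<Sum>i\<le>Suc (length xs). \<Sum>j\<le>length ys. B i j)"
    using 3 by (simp add: A_def B_def T_def del: sum.atMost_Suc)
  also have "\<dots> = (\<Sum>i\<le>Suc (length xs). \<Sum>j\<le>Suc (length ys). T i j)"
    by (simp add: T sum.atMost_Suc_shift sum.distrib del: sum.atMost_Suc)
  finally show ?case by (simp add: T_def del: sum.atMost_Suc)
qed

text \<open>Multiplicativity on the shuffle algebra. The restriction to compositions matters for
  \<open>1 / part_pi\<close>: with zero parts prefix sums may vanish, and \<open>[0]\<close>,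
  \<open>[1]\<close> violate the identity.\<close>

definition shuffle_hom :: "(nat list \<Rightarrow> 'b::comm_ring_1) \<Rightarrow> bool" where
  "shuffle_hom f \<longleftrightarrow> (\<forall>\<alpha> \<beta>. composition \<alpha> \<longrightarrow> composition \<beta> \<longrightarrow>
     (\<Sum>\<gamma>\<in>#shuffle_mset \<alpha> \<beta>. f \<gamma>) = f \<alpha> * f \<beta>)"

text \<open>By \<open>sum_shuffle_convolution\<close> each pair of cuts contributes four factors;
  commutativity of the target ring regroups them into the product of two sums.\<close>

lemma shuffle_hom_convolution:
  assumes "shuffle_hom f" "shuffle_hom g"
  shows "shuffle_hom (convolution f g)"
  unfolding shuffle_hom_def
proof (intro allI impI)
  fix \<alpha> \<beta> assume "composition \<alpha>" "composition \<beta>"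
  then show "(\<Sum>\<gamma>\<in>#shuffle_mset \<alpha> \<beta>. convolution f g \<gamma>) = convolution f g \<alpha> * convolution f g \<beta>"
    using assms
    by (simp add: sum_shuffle_convolution shuffle_hom_def composition_take composition_drop
        convolution_def[of _ _ \<alpha>] convolution_def[of _ _ \<beta>] sum_product algebra_simps)
qed

text \<open>This is the counit, the case of no variables: a shuffle is empty only if both words
  are.\<close>

lemma shuffle_hom_Nil:
  "shuffle_hom (\<lambda>\<alpha>. if \<alpha> = [] then 1 else 0 :: 'b::comm_ring_1)"
  unfolding shuffle_hom_def
proof (intro allI impI)
  fix \<alpha> \<beta> :: "nat list"
  show "(\<Sum>\<gamma>\<in>#shuffle_mset \<alpha> \<beta>. if \<gamma> = [] then 1 else 0) =
      (if \<alpha> = [] then 1 else 0) * (if \<beta> = [] then 1 else (0 :: 'b))"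
    by (cases "(\<alpha>, \<beta>)" rule: shuffle_mset.cases) (auto simp: multiset.map_comp comp_def)
qed

section \<open>One variable\<close>

lemma part_pi_Nil [simp]: "part_pi [] = 1"
  by (simp add: part_pi_def)

lemma part_pi_snoc: "part_pi (\<alpha> @ [a]) = part_pi \<alpha> * (sum_list \<alpha> + a)"
proof -
  have eq: "(\<Sum>j = 1..i. \<gamma> ! (j - 1)) = sum_list (take i \<gamma>)" if "i \<le> length \<gamma>"
    for i and \<gamma> :: "nat list"
    using that
  proof (induction i)
    case (Suc i)
    then show ?case by (simp add: take_Suc_conv_app_nth)
  qed simp
  have pi: "part_pi \<gamma> = (\<Prod>i = 1..length \<gamma>. sum_list (take i \<gamma>))" for \<gamma>
    unfolding part_pi_def by (intro prod.cong refl eq) auto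
  show ?thesis by (simp add: pi)
qed

lemma part_pi_pos: "composition \<alpha> \<Longrightarrow> 0 < part_pi \<alpha>"
  by (induction \<alpha> rule: rev_induct) (auto simp: part_pi_snoc composition_def)

text \<open>All shuffles of two words have the same sum, so their last prefix sum is a common
  factor. Removing the last letter reduces the claim, by induction on the total length, to
  \<open>1/A + 1/B = (A + B)/(A * B)\<close> for the sums \<open>A\<close> and \<open>B\<close> of
  the words.\<close>

lemma shuffle_hom_part_pi: "shuffle_hom (\<lambda>\<alpha>. 1 / of_nat (part_pi \<alpha>) :: 'a::field_char_0)"
proof -
  have "(\<Sum>\<gamma>\<in>#shuffle_mset \<alpha> \<beta>. 1 / of_nat (part_pi \<gamma>)) =
      1 / of_nat (part_pi \<alpha>) * (1 / of_nat (part_pi \<beta>) :: 'a)"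
    if "composition \<alpha>" "composition \<beta>" for \<alpha> \<beta>
    using that
  proof (induction "length \<alpha> + length \<beta>" arbitrary: \<alpha> \<beta> rule: less_induct)
    case less
    show ?case
    proof (cases "\<alpha> = [] \<or> \<beta> = []")
      case False
      then obtain \<alpha>' a \<beta>' b where ab: "\<alpha> = \<alpha>' @ [a]" "\<beta> = \<beta>' @ [b]"
        by (metis rev_exhaust)
      have comp: "composition \<alpha>'" "composition \<beta>'" and pos: "0 < a" "0 < b"
        using less.prems by (auto simp: ab composition_def)
      define s where "s = sum_list \<alpha> + sum_list \<beta>"
      have sum: "sum_list \<gamma> = sum_list us + sum_list vs" if "\<gamma> \<in># shuffle_mset us vs"
        for \<gamma> us vs :: "nat list"
        using mset_shuffle_mset[OF that] by (metis sum_mset_sum_list sum_mset.union)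
      \<comment> \<open>Whichever last letter \<open>c\<close> is removed, the full sum is
        \<open>s\<close>, so \<open>c\<close> contributes the constant factor
        \<open>1/s\<close>.\<close>
      have step: "(\<Sum>\<gamma>\<in>#shuffle_mset us vs. 1 / of_nat (part_pi (\<gamma> @ [c]))) =
          1 / of_nat (part_pi us) * (1 / of_nat (part_pi vs)) / (of_nat s :: 'a)"
        if "length us + length vs < length \<alpha> + length \<beta>" "composition us" "composition vs"
          "sum_list us + sum_list vs + c = s" for us vs c
      proof -
        have "(\<Sum>\<gamma>\<in>#shuffle_mset us vs. 1 / of_nat (part_pi (\<gamma> @ [c]))) =
            (\<Sum>\<gamma>\<in>#shuffle_mset us vs. 1 / of_nat (part_pi \<gamma>) * (1 / of_nat s :: 'a))"
        proof (intro arg_cong[where f = sum_mset] image_mset_cong)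
          fix \<gamma> assume "\<gamma> \<in># shuffle_mset us vs"
          then have "sum_list \<gamma> + c = s" using sum that(4) by simp
          then show "1 / of_nat (part_pi (\<gamma> @ [c])) =
              1 / of_nat (part_pi \<gamma>) * (1 / of_nat s :: 'a)"
            by (simp add: part_pi_snoc)
        qed
        also have "\<dots> = (\<Sum>\<gamma>\<in>#shuffle_mset us vs. 1 / of_nat (part_pi \<gamma>)) * (1 / of_nat s)"
          by (rule sum_mset_distrib_right[symmetric])
        finally show ?thesis
          using less.hyps[OF that(1-3)] by simp
      qed
      define A B :: 'a where "A = of_nat (sum_list \<alpha>)" and "B = of_nat (sum_list \<beta>)"
      define p q :: 'a where "p = of_nat (part_pi \<alpha>')" and "q = of_nat (part_pi \<beta>')"
      have nz: "A \<noteq> 0" "B \<noteq> 0" "A + B \<noteq> 0" "p \<noteq> 0" "q \<noteq> 0"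
        using pos part_pi_pos[OF comp(1)] part_pi_pos[OF comp(2)]
        by (auto simp: A_def B_def p_def q_def ab simp flip: of_nat_add)
      have pa: "of_nat (part_pi \<alpha>) = p * A" "of_nat (part_pi \<beta>) = q * B"
        by (simp_all add: ab part_pi_snoc p_def q_def A_def B_def)
      have "(\<Sum>\<gamma>\<in>#shuffle_mset \<alpha> \<beta>. 1 / of_nat (part_pi \<gamma>)) =
          (\<Sum>\<gamma>\<in>#shuffle_mset \<alpha>' \<beta>. 1 / of_nat (part_pi (\<gamma> @ [a]))) +
          (\<Sum>\<gamma>\<in>#shuffle_mset \<alpha> \<beta>'. 1 / of_nat (part_pi (\<gamma> @ [b])) :: 'a)"
        by (simp add: ab shuffle_mset_snoc multiset.map_comp comp_def)
      also have "\<dots> = 1 / p * (1 / (q * B)) / (A + B) + 1 / (p * A) * (1 / q) / (A + B)"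
        using step[of \<alpha>' \<beta> a] step[of \<alpha> \<beta>' b] comp less.prems pa
        by (simp add: ab s_def p_def q_def A_def B_def)
      also have "\<dots> = 1 / (p * A) * (1 / (q * B))"
        using nz by (simp add: divide_simps)
      finally show ?thesis by (simp add: pa)
    qed auto
  qed
  then show ?thesis by (simp add: shuffle_hom_def)
qed

section \<open>Coefficients of series and the one-variable factor\<close>

lemma coefficient_add: "coefficient (F + G) m = coefficient F m + coefficient G m"
  by transfer simp

lemma coefficient_zero: "coefficient 0 m = 0"
  by transfer simp

lemma coefficient_scale: "coefficient (scale c F) m = c * coefficient F m"
  by transfer simp

lemma coefficient_times:
  "coefficient (F * G) m = (\<Sum>(a, b) \<in> {(a, b). a + b = m}. coefficient F a * coefficient G b)"
  by (simp only: times_power_series.rep_eq)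

lemma coefficient_sum: "coefficient (\<Sum>x\<in>X. F x) m = (\<Sum>x\<in>X. coefficient (F x) m)"
  by (induction X rule: infinite_finite_induct) (simp_all add: coefficient_add coefficient_zero)

lemma coefficient_sum_mset: "coefficient (\<Sum>x\<in>#X. F x) m = (\<Sum>x\<in>#X. coefficient (F x) m)"
  by (induction X) (simp_all add: coefficient_add coefficient_zero)

text \<open>For \<open>v = []\<close> this is the series 1, so a variable absent from a monomial
  corresponds to an empty block.\<close>

lift_definition power_term :: "nat \<Rightarrow> nat list \<Rightarrow> 'a::field_char_0 power_series" is
  "\<lambda>i v m. if m = Poly_Mapping.single i (sum_list v) then 1 / of_nat (part_pi v) else 0" .

text \<open>The second factor is a multiple of one monomial, so at most one factorization of
  \<open>m\<close> contributes. Subtraction of exponents is truncated, hence the explicit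
  divisibility condition.\<close>

lemma coefficient_times_power_term:
  "coefficient (F * power_term i v) m =
    (if \<exists>a. a + Poly_Mapping.single i (sum_list v) = m
     then coefficient F (m - Poly_Mapping.single i (sum_list v)) / of_nat (part_pi v) else 0)"
    (is "_ = ?r")
proof -
  let ?s = "Poly_Mapping.single i (sum_list v)"
  let ?f = "\<lambda>(a, b). coefficient F a * coefficient (power_term i v) b"
  have "coefficient (F * power_term i v) m = (\<Sum>p\<in>{(a, b). a + b = m}. ?f p)"
    by (simp add: coefficient_times)
  also have "\<dots> = (\<Sum>p\<in>{(a, b). a + b = m \<and> b = ?s}. ?f p)"
    by (rule sum.mono_neutral_right[OF finite_monomial_factorizations])
      (auto simp: power_term.rep_eq split: if_splits)
  also have "\<dots> = ?r"
  proof (cases "\<exists>a. a + ?s = m")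
    case True
    then have "{(a, b). a + b = m \<and> b = ?s} = {(m - ?s, ?s)}" by auto
    with True show ?thesis by (simp add: power_term.rep_eq)
  next
    case False
    then have "{(a, b). a + b = m \<and> b = ?s} = {}" by auto
    with False show ?thesis by (simp only: sum.empty if_False)
  qed
  finally show ?thesis .
qed

text \<open>Shuffling preserves the sum, so all terms carry the same monomial and
  \<open>shuffle_hom_part_pi\<close> handles the scalars.\<close>

lemma shuffle_hom_power_term: "shuffle_hom (power_term i :: _ \<Rightarrow> 'a::field_char_0 power_series)"
  unfolding shuffle_hom_def
proof (intro allI impI power_series_eqI)
  fix \<alpha> \<beta> m assume comp: "composition \<alpha>" "composition \<beta>"
  let ?s = "Poly_Mapping.single i (sum_list \<alpha> + sum_list \<beta>)"
  have "coefficient (\<Sum>\<gamma>\<in>#shuffle_mset \<alpha> \<beta>. power_term i \<gamma> :: 'a power_series) m =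
      (\<Sum>\<gamma>\<in>#shuffle_mset \<alpha> \<beta>. 1 / of_nat (part_pi \<gamma>) * (if m = ?s then 1 else 0))"
    unfolding coefficient_sum_mset
  proof (intro arg_cong[where f = sum_mset] image_mset_cong)
    fix \<gamma> assume "\<gamma> \<in># shuffle_mset \<alpha> \<beta>"
    then have "sum_list \<gamma> = sum_list \<alpha> + sum_list \<beta>"
      using mset_shuffle_mset by (metis sum_mset_sum_list sum_mset.union)
    then show "coefficient (power_term i \<gamma>) m =
        1 / of_nat (part_pi \<gamma>) * (if m = ?s then 1 else (0 :: 'a))"
      by (simp add: power_term.rep_eq)
  qed
  also have "\<dots> = 1 / of_nat (part_pi \<alpha>) * (1 / of_nat (part_pi \<beta>)) * (if m = ?s then 1 else 0)"
    using comp shuffle_hom_part_pi[where 'a = 'a]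
    by (simp only: sum_mset_distrib_right[symmetric] shuffle_hom_def)
  also have "\<dots> = coefficient (power_term i \<alpha> * power_term i \<beta>) m"
    by (cases "m = ?s") (auto simp: coefficient_times_power_term power_term.rep_eq single_add)
  finally show "coefficient (\<Sum>\<gamma>\<in>#shuffle_mset \<alpha> \<beta>. power_term i \<gamma> :: 'a power_series) m =
      coefficient (power_term i \<alpha> * power_term i \<beta>) m" .
qed

section \<open>Finitely many variables\<close>

primrec truncated :: "nat \<Rightarrow> nat list \<Rightarrow> 'a::field_char_0 power_series" where
  "truncated 0 = (\<lambda>\<alpha>. if \<alpha> = [] then 1 else 0)"
| "truncated (Suc N) = convolution (truncated N) (power_term N)"

lemma shuffle_hom_truncated: "shuffle_hom (truncated N)"
  by (induction N) (simp_all add: shuffle_hom_Nil shuffle_hom_convolution shuffle_hom_power_term)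

text \<open>The coefficient of \<open>monomial_qsym \<beta>\<close> in \<open>Psi \<alpha>\<close>
  divided by \<open>zee \<alpha>\<close>, extended by 0 to all \<open>\<beta>\<close>.\<close>

definition refinement_weight :: "nat list \<Rightarrow> nat list \<Rightarrow> 'a::field_char_0" where
  "refinement_weight \<alpha> \<beta> = (if refines \<alpha> \<beta> then 1 / of_nat (refinement_pi \<alpha> \<beta>) else 0)"

lemma refinement_weight_Nil:
  "composition \<alpha> \<Longrightarrow> refinement_weight \<alpha> [] = (if \<alpha> = [] then 1 else 0)"
proof -
  assume "composition \<alpha>"
  have "composition []" by (simp add: composition_def)
  then have "blocks [] [] = []" by (intro blocks_eqI) simp_all
  moreover have "refines \<alpha> [] \<longleftrightarrow> \<alpha> = []"
    using \<open>composition \<alpha>\<close> \<open>composition []\<close> by (auto simp: refines_def)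
  ultimately show ?thesis by (simp add: refinement_weight_def refinement_pi_def)
qed

lemma refines_snoc:
  assumes "composition \<alpha>" "composition (\<beta> @ [b])" "refines \<alpha> (\<beta> @ [b])"
  obtains k where "k \<le> length \<alpha>" "sum_list (drop k \<alpha>) = b" "refines (take k \<alpha>) \<beta>"
proof -
  from assms(3) obtain \<alpha>s where "concat \<alpha>s = \<alpha>" "map sum_list \<alpha>s = \<beta> @ [b]"
    by (auto simp: refines_def)
  then obtain \<alpha>s' v where v: "\<alpha> = concat \<alpha>s' @ v" "map sum_list \<alpha>s' = \<beta>" "sum_list v = b"
    by (auto simp: map_eq_append_conv)
  show ?thesis
    by (rule that[of "length (concat \<alpha>s')"])
      (use v assms in \<open>auto simp: refines_def composition_def\<close>)
qed

text \<open>Positive parts force the last block to be exactly \<open>v\<close>, so both refinements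
  and blocks correspond, and \<open>part_pi v\<close> splits off as the last factor.\<close>

lemma refinement_weight_append:
  assumes "composition (u @ v)" "composition \<beta>" "0 < sum_list v"
  shows "refinement_weight (u @ v) (\<beta> @ [sum_list v]) =
    (refinement_weight u \<beta> / of_nat (part_pi v) :: 'a::field_char_0)"
proof (cases "refines u \<beta>")
  case True
  then obtain us where us: "concat us = u" "map sum_list us = \<beta>"
    by (auto simp: refines_def)
  have comp: "composition u" "composition (\<beta> @ [sum_list v])"
    using assms by (auto simp: composition_def)
  have "blocks u \<beta> = us" "blocks (u @ v) (\<beta> @ [sum_list v]) = us @ [v]"
    using us assms comp by (auto intro!: blocks_eqI)
  moreover have "refines (u @ v) (\<beta> @ [sum_list v])"
    unfolding refines_def using assms comp us by (auto intro!: exI[of _ "us @ [v]"])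
  ultimately show ?thesis
    using True by (simp add: refinement_weight_def refinement_pi_def)
next
  case False
  have "\<not> refines (u @ v) (\<beta> @ [sum_list v])"
  proof
    assume r: "refines (u @ v) (\<beta> @ [sum_list v])"
    then obtain ws where "concat ws = u @ v" "map sum_list ws = \<beta> @ [sum_list v]"
      by (auto simp: refines_def)
    moreover from this(2) obtain us w where "ws = us @ [w]" "map sum_list us = \<beta>"
        "sum_list w = sum_list v"
      by (auto simp: map_eq_append_conv)
    ultimately have w: "u @ v = concat us @ w" "map sum_list us = \<beta>" "sum_list w = sum_list v"
      by simp_all
    have nil: "us = []" if "sum_list us = (0::nat)" "\<forall>u\<in>set us. 0 < u" for us
      using that by (cases us) auto
    have pos: "\<forall>x\<in>set (u @ v). 0 < x" "\<forall>x\<in>set (concat us @ w). 0 < x"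
      using assms(1) unfolding composition_def w(1) by auto
    \<comment> \<open>Of the two suffixes \<open>v\<close> and \<open>w\<close> one extends the
      other by \<open>zs\<close>; equal sums and positive parts make \<open>zs\<close>
      empty.\<close>
    obtain zs where "u = concat us @ zs \<and> w = zs @ v \<or> concat us = u @ zs \<and> v = zs @ w"
      using w(1) unfolding append_eq_append_conv2 by metis
    then have "u = concat us" using w(3) pos nil[of zs] by auto
    then have "refines u \<beta>"
      unfolding refines_def using w(2) assms by (auto simp: composition_def)
    with False show False by blast
  qed
  with False show ?thesis by (simp add: refinement_weight_def)
qed

lemma sum_list_drop_inj:
  assumes "composition \<alpha>" "sum_list (drop k \<alpha>) = sum_list (drop l \<alpha>)"
    and "k \<le> length \<alpha>" "l \<le> length \<alpha>"
  shows "k = l"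
proof -
  have *: False if "k < l" "l \<le> length \<alpha>" "sum_list (drop k \<alpha>) = sum_list (drop l \<alpha>)" for k l
  proof -
    have "drop k \<alpha> = \<alpha> ! k # drop (Suc k) \<alpha>" using that by (simp add: Cons_nth_drop_Suc)
    moreover have "drop (Suc k) \<alpha> = take (l - Suc k) (drop (Suc k) \<alpha>) @ drop l \<alpha>"
      using that append_take_drop_id[of "l - Suc k" "drop (Suc k) \<alpha>"] by simp
    ultimately have "drop k \<alpha> = \<alpha> ! k # take (l - Suc k) (drop (Suc k) \<alpha>) @ drop l \<alpha>"
      by (simp only:)
    then have "sum_list (drop k \<alpha>) =
        sum_list (\<alpha> ! k # take (l - Suc k) (drop (Suc k) \<alpha>) @ drop l \<alpha>)"
      by (rule arg_cong)
    moreover have "0 < \<alpha> ! k" using assms(1) that by (auto simp: composition_def)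
    ultimately show False using that by simp
  qed
  show ?thesis using *[of k l] *[of l k] assms by (metis linorder_neqE_nat)
qed

text \<open>Suffix sums strictly decrease, so at most one cut has suffix sum \<open>b\<close>. The
  sum over all cuts is the form in which a convolution produces this value.\<close>

lemma refinement_weight_snoc:
  assumes "composition \<alpha>" "composition \<beta>" "0 < b"
  shows "(refinement_weight \<alpha> (\<beta> @ [b]) :: 'a::field_char_0) =
    (\<Sum>k\<le>length \<alpha>. if sum_list (drop k \<alpha>) = b
       then refinement_weight (take k \<alpha>) \<beta> / of_nat (part_pi (drop k \<alpha>)) else 0)"
proof (cases "\<exists>k\<le>length \<alpha>. sum_list (drop k \<alpha>) = b")
  case True
  then obtain k where k: "k \<le> length \<alpha>" "sum_list (drop k \<alpha>) = b" by blast
  have iff: "sum_list (drop l \<alpha>) = b \<longleftrightarrow> l = k" if "l \<le> length \<alpha>" for l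
  proof
    assume "sum_list (drop l \<alpha>) = b"
    with k(2) have "sum_list (drop l \<alpha>) = sum_list (drop k \<alpha>)" by simp
    then show "l = k" using sum_list_drop_inj[OF assms(1)] that k(1) by blast
  qed (simp add: k)
  have "(\<Sum>l\<le>length \<alpha>. if sum_list (drop l \<alpha>) = b
       then refinement_weight (take l \<alpha>) \<beta> / of_nat (part_pi (drop l \<alpha>)) else 0) =
     (\<Sum>l\<le>length \<alpha>. if l = k
       then refinement_weight (take l \<alpha>) \<beta> / of_nat (part_pi (drop l \<alpha>)) else (0::'a))"
    by (intro sum.cong refl if_cong) (simp_all only: atMost_iff iff)
  also have "\<dots> = refinement_weight (take k \<alpha>) \<beta> / of_nat (part_pi (drop k \<alpha>))"
    using k(1) by simp
  also have "\<dots> = refinement_weight (take k \<alpha> @ drop k \<alpha>) (\<beta> @ [sum_list (drop k \<alpha>)])"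
    by (rule refinement_weight_append[symmetric]) (simp_all only: k(2) assms append_take_drop_id)
  finally show ?thesis by (simp only: append_take_drop_id k(2))
next
  case False
  have "composition (\<beta> @ [b])" using assms by (auto simp: composition_def)
  then have "\<not> refines \<alpha> (\<beta> @ [b])"
    using refines_snoc[OF assms(1)] False by blast
  moreover have "(\<Sum>k\<le>length \<alpha>. if sum_list (drop k \<alpha>) = b
       then refinement_weight (take k \<alpha>) \<beta> / of_nat (part_pi (drop k \<alpha>)) else 0) = (0::'a)"
    by (intro sum.neutral ballI if_not_P) (use False in auto)
  ultimately show ?thesis by (simp only: refinement_weight_def if_False)
qed

text \<open>If all variables of \<open>m\<close> have index below \<open>N\<close>, this is the
  unique composition whose monomial quasisymmetric function contains \<open>m\<close>.\<close>

definition exponents :: "nat \<Rightarrow> monomial \<Rightarrow> nat list" where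
  "exponents N m = filter (\<lambda>e. 0 < e) (map (Poly_Mapping.lookup m) [0..<N])"

lemma composition_exponents: "composition (exponents N m)"
  by (auto simp: exponents_def composition_def)

text \<open>Induction on the number of variables: the exponent of the newest variable prescribes the
  sum of the last block, and the remaining blocks are governed by the earlier variables.\<close>

lemma coefficient_truncated:
  assumes "composition \<alpha>"
  shows "coefficient (truncated N \<alpha>) m =
    (if Poly_Mapping.keys m \<subseteq> {..<N} then refinement_weight \<alpha> (exponents N m)
     else (0 :: 'a::field_char_0))"
  using assms
proof (induction N arbitrary: \<alpha> m)
  case 0
  then show ?case
    by (simp add: refinement_weight_Nil exponents_def one_power_series.rep_eq coefficient_zero)
next
  case (Suc N)
  let ?in = "Poly_Mapping.keys m \<subseteq> {..<Suc N}"
  have sN: "Poly_Mapping.lookup a N = 0" if "Poly_Mapping.keys a \<subseteq> {..<N}" for a :: monomial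
    using that by (auto simp: in_keys_iff)
  \<comment> \<open>The first factor involves only variables below \<open>N\<close>, so the power of
    variable \<open>N\<close> must come entirely from \<open>v\<close>.\<close>
  have coeff: "coefficient (truncated N u * power_term N v) m =
      (if ?in \<and> sum_list v = Poly_Mapping.lookup m N
       then refinement_weight u (exponents N m) / of_nat (part_pi v) else (0 :: 'a))"
    if u: "composition u" for u v
  proof (cases "?in \<and> sum_list v = Poly_Mapping.lookup m N")
    case True
    let ?s = "Poly_Mapping.single N (sum_list v)"
    have eq: "(m - ?s) + ?s = m"
      by (rule poly_mapping_eqI) (use True in \<open>auto simp: lookup_add lookup_minus lookup_single when_def\<close>)
    have "Poly_Mapping.keys (m - ?s) \<subseteq> {..<N}"
      using True by (auto simp: in_keys_iff lookup_minus lookup_single when_def less_Suc_eq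
        subset_iff split: if_splits)
    moreover have "map (Poly_Mapping.lookup (m - ?s)) [0..<N] = map (Poly_Mapping.lookup m) [0..<N]"
      by (intro map_cong refl) (auto simp: lookup_minus lookup_single when_def)
    then have "exponents N (m - ?s) = exponents N m"
      by (simp only: exponents_def)
    ultimately have "coefficient (truncated N u) (m - ?s) =
        (refinement_weight u (exponents N m) :: 'a)"
      by (simp only: Suc.IH[OF u] if_True)
    moreover have "\<exists>a. a + ?s = m"
      using eq by blast
    ultimately show ?thesis
      unfolding coefficient_times_power_term using True by (simp only: if_True simp_thms)
  next
    case False
    have "?in \<and> sum_list v = Poly_Mapping.lookup m N"
      if a: "a + Poly_Mapping.single N (sum_list v) = m" "Poly_Mapping.keys a \<subseteq> {..<N}" for a
    proof -
      have "Poly_Mapping.lookup m j = Poly_Mapping.lookup a j + (if N = j then sum_list v else 0)" for j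
        by (simp add: lookup_add lookup_single when_def flip: a(1))
      then show ?thesis
        using sN[OF a(2)] a(2) by (auto simp: in_keys_iff subset_iff less_Suc_eq split: if_splits)
    qed
    with False have "coefficient (truncated N u) a = (0 :: 'a)"
      if "a + Poly_Mapping.single N (sum_list v) = m" for a
      using that Suc.IH[OF u, of a] by (metis (no_types, lifting))
    then have "coefficient (truncated N u * power_term N v) m = (0 :: 'a)"
      unfolding coefficient_times_power_term by (metis add_diff_cancel_right' div_0)
    with False show ?thesis by (simp only: if_False)
  qed
  define w :: "nat \<Rightarrow> 'a" where
    "w k = refinement_weight (take k \<alpha>) (exponents N m) / of_nat (part_pi (drop k \<alpha>))" for k
  have "coefficient (truncated (Suc N) \<alpha>) m =
      (\<Sum>k\<le>length \<alpha>. coefficient (truncated N (take k \<alpha>) * power_term N (drop k \<alpha>)) m :: 'a)"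
    by (simp only: truncated.simps convolution_def coefficient_sum)
  also have "\<dots> =
      (\<Sum>k\<le>length \<alpha>. if ?in \<and> sum_list (drop k \<alpha>) = Poly_Mapping.lookup m N then w k else 0)"
    by (simp only: coeff[OF composition_take[OF Suc.prems]] w_def)
  also have "\<dots> = (if ?in
      then \<Sum>k\<le>length \<alpha>. if sum_list (drop k \<alpha>) = Poly_Mapping.lookup m N then w k else 0 else 0)"
    by (cases ?in) (simp_all only: simp_thms if_True if_False sum.neutral_const)
  also have "(\<Sum>k\<le>length \<alpha>. if sum_list (drop k \<alpha>) = Poly_Mapping.lookup m N then w k else 0) =
      refinement_weight \<alpha> (exponents (Suc N) m)"
  \<comment> \<open>With exponent 0 the last block is empty, only the cut at the end survives, and
    \<open>exponents\<close> does not change. Otherwise \<open>exponents\<close> gains a last part,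
    and \<open>refinement_weight_snoc\<close> applies.\<close>
  proof (cases "Poly_Mapping.lookup m N = 0")
    case True
    have last: "sum_list (drop (length \<alpha>) \<alpha>) = Poly_Mapping.lookup m N"
      by (simp add: True)
    have iff: "sum_list (drop k \<alpha>) = Poly_Mapping.lookup m N \<longleftrightarrow> k = length \<alpha>"
      if "k \<le> length \<alpha>" for k
      using sum_list_drop_inj[OF Suc.prems _ that le_refl] last by metis
    have "(\<Sum>k\<le>length \<alpha>. if sum_list (drop k \<alpha>) = Poly_Mapping.lookup m N then w k else 0) =
        (\<Sum>k\<le>length \<alpha>. if k = length \<alpha> then w k else 0)"
      by (intro sum.cong refl if_cong) (simp_all only: atMost_iff iff)
    also have "\<dots> = w (length \<alpha>)"
      by simp
    also have "\<dots> = refinement_weight \<alpha> (exponents N m)"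
      by (simp add: w_def)
    also have "exponents N m = exponents (Suc N) m"
      by (simp add: exponents_def True)
    finally show ?thesis .
  next
    case False
    then have "exponents (Suc N) m = exponents N m @ [Poly_Mapping.lookup m N]"
      by (simp add: exponents_def)
    moreover have "0 < Poly_Mapping.lookup m N"
      using False by simp
    ultimately show ?thesis
      by (simp only: w_def refinement_weight_snoc[OF Suc.prems composition_exponents])
  qed
  finally show ?case .
qed

section \<open>Power sums\<close>

text \<open>With distinct indices no two exponents merge, so they can be read back.\<close>

lemma lookup_index_monomial:
  assumes "length is = length \<beta>" "distinct is"
  shows "map (Poly_Mapping.lookup (sum_list (map2 Poly_Mapping.single is \<beta>))) is = \<beta>"
  using assms
proof (induction "is" \<beta> rule: list_induct2)
  case (Cons i "is" b \<beta>)
  have "Poly_Mapping.lookup (sum_list (map2 Poly_Mapping.single is \<beta>)) i = 0"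
    using Cons.hyps Cons.prems
    by (induction "is" \<beta> rule: list_induct2) (auto simp: lookup_add lookup_single when_def)
  moreover have "map (Poly_Mapping.lookup (Poly_Mapping.single i b + sum_list (map2 Poly_Mapping.single is \<beta>))) is =
      map (Poly_Mapping.lookup (sum_list (map2 Poly_Mapping.single is \<beta>))) is"
    using Cons.prems by (intro map_cong refl) (auto simp: lookup_add lookup_single when_def)
  ultimately show ?case using Cons by (simp add: lookup_add[of _ _ i] del: map_eq_conv)
qed simp

lemma sum_list_single_lookup:
  assumes "distinct is" "set is = Poly_Mapping.keys m"
  shows "sum_list (map2 Poly_Mapping.single is (map (Poly_Mapping.lookup m) is)) = (m :: monomial)"
proof -
  have "sum_list (map2 Poly_Mapping.single is (map (Poly_Mapping.lookup m) is)) =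
      (\<Sum>i\<in>Poly_Mapping.keys m. Poly_Mapping.single i (Poly_Mapping.lookup m i))"
    using assms by (simp add: zip_map2 zip_same_conv_map comp_def sum_list_distinct_conv_sum_set)
  also have "\<dots> = m"
    by (rule poly_mapping_eqI) (auto simp: lookup_sum lookup_single when_def in_keys_iff)
  finally show ?thesis .
qed

text \<open>A strictly increasing index sequence is determined by its set, which must be the support
  of \<open>m\<close>; the exponents then determine \<open>\<beta>\<close>.\<close>

lemma coefficient_monomial_qsym:
  assumes "composition \<beta>" "Poly_Mapping.keys m \<subseteq> {..<N}"
  shows "coefficient (monomial_qsym \<beta>) m = (if \<beta> = exponents N m then 1 else 0)"
proof -
  define ks where "ks = filter (\<lambda>i. 0 < Poly_Mapping.lookup m i) [0..<N]"
  have ks: "sorted_wrt (<) ks" "distinct ks" "set ks = Poly_Mapping.keys m"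
    using assms(2) by (auto simp: ks_def in_keys_iff intro: sorted_wrt_filter)
  have ex: "map (Poly_Mapping.lookup m) ks = exponents N m"
    by (simp add: exponents_def ks_def filter_map comp_def)
  let ?S = "{is. length is = length \<beta> \<and> sorted_wrt (<) is \<and>
      sum_list (map2 Poly_Mapping.single is \<beta>) = m}"
  have sub: "is = ks" "\<beta> = exponents N m" if "is \<in> ?S" for "is"
  proof -
    from that have "is": "length is = length \<beta>" "sorted_wrt (<) is"
        "sum_list (map2 Poly_Mapping.single is \<beta>) = m"
      by simp_all
    have "set is = Poly_Mapping.keys m"
      using keys_index_monomial[OF assms(1) "is"(1)] "is"(3) by simp
    then show "is = ks"
      using strict_sorted_equal[OF "is"(2) ks(1)] ks(3) by simp
    moreover have "distinct is"
      using "is"(2) by (simp add: strict_sorted_iff)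
    ultimately show "\<beta> = exponents N m"
      using lookup_index_monomial[OF "is"(1)] "is"(3) ex by simp
  qed
  have "?S = (if \<beta> = exponents N m then {ks} else {})"
  proof (cases "\<beta> = exponents N m")
    case True
    have "ks \<in> ?S"
      using ks(1) sum_list_single_lookup[OF ks(2,3)] ex True
      by (metis (mono_tags, lifting) length_map mem_Collect_eq)
    then have "?S = {ks}" using sub(1) by blast
    with True show ?thesis by (simp only: if_True simp_thms)
  next
    case False
    then have "?S = {}" using sub(2) by blast
    with False show ?thesis by (simp only: if_False)
  qed
  then have "card ?S = (if \<beta> = exponents N m then 1 else 0)"
    by (simp only:) simp
  then show ?thesis
    by (simp only: monomial_qsym.rep_eq) simp
qed

text \<open>Among the coarsenings of \<open>\<alpha>\<close> only \<open>exponents N m\<close> can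
  contribute, so on monomials in the first \<open>N\<close> variables \<open>Psi\<close> is a
  multiple of \<open>truncated N\<close>.\<close>

lemma coefficient_Psi:
  assumes "Poly_Mapping.keys m \<subseteq> {..<N}" "composition \<alpha>"
  shows "coefficient (Psi \<alpha> :: 'a::field_char_0 power_series) m =
    of_nat (zee \<alpha>) * coefficient (truncated N \<alpha>) m"
proof -
  have "(\<Sum>\<beta> | refines \<alpha> \<beta>. 1 / of_nat (refinement_pi \<alpha> \<beta>) * coefficient (monomial_qsym \<beta>) m) =
      (\<Sum>\<beta> | refines \<alpha> \<beta>. if \<beta> = exponents N m
        then 1 / of_nat (refinement_pi \<alpha> \<beta>) else (0 :: 'a))"
    using coefficient_monomial_qsym[OF _ assms(1), where 'a = 'a]
    by (intro sum.cong refl) (simp add: refines_def)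
  also have "\<dots> = refinement_weight \<alpha> (exponents N m)"
    by (simp add: finite_coarsenings refinement_weight_def)
  finally show ?thesis
    using assms
    by (simp add: Psi_def coefficient_scale coefficient_sum coefficient_truncated[where N = N])
qed

section \<open>The constants z and C, and the product formula\<close>

lemma zee_eq_prod:
  assumes "finite A" "set \<alpha> \<subseteq> A"
  shows "zee \<alpha> = (\<Prod>i\<in>A. i ^ count_list \<alpha> i * fact (count_list \<alpha> i))"
  unfolding zee_def using assms by (intro prod.mono_neutral_left) auto

text \<open>\<open>zee\<close> depends only on the multiplicities of the parts, which add under
  shuffling; each factorial of a sum splits off a binomial coefficient.\<close>

lemma zee_shuffle:
  assumes "\<gamma> \<in># shuffle_mset \<alpha> \<beta>"
  shows "zee \<gamma> = shuffle_coeff \<alpha> \<beta> * zee \<alpha> * zee \<beta>"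
proof -
  let ?A = "set \<alpha> \<union> set \<beta>"
  have m: "mset \<gamma> = mset \<alpha> + mset \<beta>" using assms by (rule mset_shuffle_mset)
  have "set \<gamma> \<subseteq> ?A" using assms set_shuffles[of \<gamma> \<alpha> \<beta>] by (simp add: set_shuffle_mset)
  have c: "count_list \<gamma> i = count_list \<alpha> i + count_list \<beta> i" for i
    using m by (metis count_mset count_union)
  have f: "fact (a + b) = (a + b choose a) * fact a * (fact b :: nat)" for a b :: nat
    using binomial_fact_lemma[of a "a + b"] by (simp add: algebra_simps)
  let ?f = "\<lambda>\<delta> i. i ^ count_list \<delta> i * fact (count_list \<delta> i) :: nat"
  have "zee \<gamma> = (\<Prod>i\<in>?A. ?f \<gamma> i)"
    using \<open>set \<gamma> \<subseteq> ?A\<close> by (intro zee_eq_prod) auto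
  also have "\<dots> = (\<Prod>i\<in>?A. (count_list \<alpha> i + count_list \<beta> i choose count_list \<alpha> i) * ?f \<alpha> i * ?f \<beta> i)"
    by (intro prod.cong refl) (simp only: c f power_add mult_ac)
  also have "\<dots> = shuffle_coeff \<alpha> \<beta> * zee \<alpha> * zee \<beta>"
    using zee_eq_prod[of ?A \<alpha>] zee_eq_prod[of ?A \<beta>]
    by (simp add: shuffle_coeff_def prod.distrib)
  finally show ?thesis .
qed

lemma shuffle_coeff_pos: "0 < shuffle_coeff \<alpha> \<beta>"
  unfolding shuffle_coeff_def by (intro prod_pos) simp

theorem theorem5p3:
  fixes \<alpha> \<beta> :: "nat list"
  assumes "composition \<alpha>" and "composition \<beta>"
  shows "(Psi \<alpha> * Psi \<beta> :: 'a::field_char_0 power_series) =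
    scale (1 / of_nat (shuffle_coeff \<alpha> \<beta>)) (\<Sum>\<gamma> \<in># shuffle_mset \<alpha> \<beta>. Psi \<gamma>)"
proof (rule power_series_eqI)
  fix m :: monomial
  \<comment> \<open>Every divisor of \<open>m\<close> involves only variables of \<open>m\<close>,
    so one \<open>N\<close> serves all factorizations.\<close>
  obtain N where N: "Poly_Mapping.keys m \<subseteq> {..<N}"
    using finite_nat_set_iff_bounded[of "Poly_Mapping.keys m"] by auto
  let ?z = "of_nat (zee \<alpha>) * of_nat (zee \<beta>) :: 'a"
  let ?c = "of_nat (shuffle_coeff \<alpha> \<beta>) :: 'a"
  have "coefficient (Psi \<alpha> * Psi \<beta> :: 'a power_series) m =
      (\<Sum>(a, b)\<in>{(a, b). a + b = m}.
        ?z * (coefficient (truncated N \<alpha>) a * coefficient (truncated N \<beta>) b))"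
    unfolding coefficient_times
  proof (intro sum.cong refl, clarify)
    fix a b assume "m = a + b"
    then have "Poly_Mapping.keys a \<subseteq> {..<N}" "Poly_Mapping.keys b \<subseteq> {..<N}"
      using N by (auto simp: in_keys_iff lookup_add subset_iff)
    then show "coefficient (Psi \<alpha>) a * coefficient (Psi \<beta>) b =
        ?z * (coefficient (truncated N \<alpha>) a * coefficient (truncated N \<beta>) b)"
      using assms by (simp add: coefficient_Psi[where N = N])
  qed
  also have "\<dots> = ?z * coefficient (truncated N \<alpha> * truncated N \<beta>) m"
    by (simp add: coefficient_times sum_distrib_left case_prod_unfold)
  also have "\<dots> = (\<Sum>\<gamma>\<in>#shuffle_mset \<alpha> \<beta>. ?z * coefficient (truncated N \<gamma>) m)"
    using shuffle_hom_truncated[of N, where 'a = 'a] assms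
    unfolding shuffle_hom_def sum_mset_distrib_left[symmetric] coefficient_sum_mset[symmetric]
    by simp
  also have "\<dots> = (\<Sum>\<gamma>\<in>#shuffle_mset \<alpha> \<beta>. 1 / ?c * coefficient (Psi \<gamma>) m)"
  \<comment> \<open>By \<open>zee_shuffle\<close>, \<open>?z\<close> equals
    \<open>zee \<gamma> / ?c\<close> for every shuffle, which turns each summand into a coefficient
    of \<open>Psi \<gamma>\<close>.\<close>
  proof (intro arg_cong[where f = sum_mset] image_mset_cong)
    fix \<gamma> assume \<gamma>: "\<gamma> \<in># shuffle_mset \<alpha> \<beta>"
    show "?z * coefficient (truncated N \<gamma>) m = 1 / ?c * coefficient (Psi \<gamma>) m"
      using coefficient_Psi[OF N composition_shuffle[OF assms \<gamma>], where 'a = 'a] zee_shuffle[OF \<gamma>]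
        shuffle_coeff_pos[of \<alpha> \<beta>] by (simp add: field_simps)
  qed
  also have "\<dots> = coefficient
      (scale (1 / ?c) (\<Sum>\<gamma> \<in># shuffle_mset \<alpha> \<beta>. Psi \<gamma>)) m"
    by (simp add: coefficient_scale coefficient_sum_mset sum_mset_distrib_left)
  finally show "coefficient (Psi \<alpha> * Psi \<beta> :: 'a power_series) m = \<dots>" .
qed

end
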